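(* Let $L$ be an irreducible almost lower-triangular transition matrix of finite size, indexed by $[0,s]\times[0,s]$. For any constant $c>0$, set for $a\in[0,s]$ $$\eta_a=c\,\det(\mathrm{Id}-L_{[a+1,s]})\prod_{i=1}^{a}L_{i-1,i}.$$ Then the measure $(\eta_a,a\in[0,s])$ is invariant by $L$ (and it is the unique invariant measure up to a positive factor).
   Context: $[a,b]=\{a,\dots,b\}$ is an integer interval. A transition matrix (non-negative entries, rows summing to $1$) $L=[L_{i,j}]_{0\le i,j\le s}$ is almost lower-triangular if $L_{i,j}>0\Rightarrow j\le i+1$. $L_{[a,b]}=[L_{i,j}]_{a\le i,j\le b}$, $\mathrm{Id}$ is the identity matrix of the appropriate size; the determinant of an empty matrix and empty products equal $1$. A measure $\eta$ is invariant by $L$ if $\sum_a\eta_aL_{a,b}=\eta_b$ for all $b$; measures are non-negative and non-zero. *)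

theory Defs
  imports "Jordan_Normal_Form.Determinant" "Jordan_Normal_Form.DL_Submatrix"
begin

text \<open>Matrices indexed by \<open>[0,s] \<times> [0,s]\<close> are matrices of dimension \<open>Suc s\<close>; measures on
  \<open>[0,s]\<close> are vectors of dimension \<open>Suc s\<close>.\<close>

definition transition_matrix :: "nat \<Rightarrow> real mat \<Rightarrow> bool" where
  "transition_matrix s L \<longleftrightarrow>
     L \<in> carrier_mat (Suc s) (Suc s) \<and>
     (\<forall>i\<in>{0..s}. \<forall>j\<in>{0..s}. L $$ (i, j) \<ge> 0) \<and>
     (\<forall>i\<in>{0..s}. (\<Sum>j\<in>{0..s}. L $$ (i, j)) = 1)"

definition almost_lower_triangular :: "nat \<Rightarrow> real mat \<Rightarrow> bool" where
  "almost_lower_triangular s L \<longleftrightarrow>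
     (\<forall>i\<in>{0..s}. \<forall>j\<in>{0..s}. L $$ (i, j) > 0 \<longrightarrow> j \<le> i + 1)"

text \<open>Every state leads to every state. Allowing \<open>n = 0\<close> only concerns \<open>i = j\<close>, and makes no
  difference for transition matrices.\<close>

definition irreducible_matrix :: "nat \<Rightarrow> real mat \<Rightarrow> bool" where
  "irreducible_matrix s L \<longleftrightarrow>
     (\<forall>i\<in>{0..s}. \<forall>j\<in>{0..s}. \<exists>n. (L ^\<^sub>m n) $$ (i, j) > 0)"

definition is_measure :: "nat \<Rightarrow> real vec \<Rightarrow> bool" where
  "is_measure s \<mu> \<longleftrightarrow>
     \<mu> \<in> carrier_vec (Suc s) \<and> (\<forall>a\<in>{0..s}. \<mu> $ a \<ge> 0) \<and> \<mu> \<noteq> 0\<^sub>v (Suc s)"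

definition invariant_measure :: "nat \<Rightarrow> real mat \<Rightarrow> real vec \<Rightarrow> bool" where
  "invariant_measure s L \<mu> \<longleftrightarrow>
     is_measure s \<mu> \<and> (\<forall>b\<in>{0..s}. (\<Sum>a\<in>{0..s}. \<mu> $ a * L $$ (a, b)) = \<mu> $ b)"

definition block :: "real mat \<Rightarrow> nat \<Rightarrow> nat \<Rightarrow> real mat" where
  "block L a b = submatrix L {a..b} {a..b}"

text \<open>The block \<open>[a+1,s]\<close> has size \<open>s - a\<close>. For \<open>a = s\<close> it is empty, with determinant \<open>1\<close>.\<close>

definition eta :: "nat \<Rightarrow> real mat \<Rightarrow> real \<Rightarrow> real vec" where
  "eta s L c = vec (Suc s) (\<lambda>a.
     c * det (1\<^sub>m (s - a) - block L (a + 1) s) * (\<Prod>i\<in>{1..a}. L $$ (i - 1, i)))"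

end

theory Submission
  imports Defs
begin

text \<open>
  Put \<open>A = Id - L\<close>. Since the rows of \<open>L\<close> sum to 1, \<open>A\<close> kills the constant vector, so
  \<open>det A = 0\<close> and \<open>adj A * A = 0\<close>: every row \<open>x\<close> of the adjugate satisfies \<open>x L = x\<close>.
  Row \<open>0\<close> consists of the cofactors of the entries \<open>(a, 0)\<close>. As \<open>A\<close> vanishes above the superdiagonal,
  deleting row \<open>a\<close> and column \<open>0\<close> leaves a block lower-triangular matrix, whose first block is
  triangular with the entries \<open>- L\<^bsub>i-1,i\<^esub>\<close>, \<open>1 \<le> i \<le> a\<close>, on its diagonal, and whose second block is
  \<open>Id - L\<^bsub>[a+1,s]\<^esub>\<close>. The signs of the cofactor and of the superdiagonal cancel, so row \<open>0\<close> of
  \<open>adj A\<close> is exactly \<open>\<eta>\<close> for \<open>c = 1\<close> (\<open>cofactor_first_column\<close> and \<open>eta_cofactor\<close>).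

  What remains is positivity and uniqueness. Both follow from balancing the flow across the cut
  between \<open>[0,k]\<close> and \<open>[k+1,s]\<close>: the only upward transition across it is \<open>k \<rightarrow> k+1\<close>, so that
  \<open>x\<^sub>k L\<^bsub>k,k+1\<^esub>\<close> is a combination with non-negative coefficients of the \<open>x\<^sub>a\<close>, \<open>a > k\<close> (\<open>cut_balance\<close>).
  Irreducibility makes \<open>L\<^bsub>k,k+1\<^esub>\<close> positive, so an invariant vector is determined by its last
  coordinate, and is non-negative as soon as this coordinate is. The last coordinate of \<open>\<eta>\<close> is
  positive because its determinant is that of the empty matrix and its product consists of the
  entries \<open>L\<^bsub>i-1,i\<^esub>\<close>.
\<close>

section \<open>Cofactors of matrices that vanish above the superdiagonal\<close>

text \<open>Deleting column \<open>0\<close> moves the superdiagonal of the first \<open>a\<close> rows onto the diagonal, and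
  deleting row \<open>a\<close> puts the remaining diagonal entries back on the diagonal. Hence the minor is block
  triangular.\<close>

lemma cofactor_first_column:
  fixes A :: "'a :: idom mat"
  assumes A: "A \<in> carrier_mat (Suc s) (Suc s)" and a: "a \<le> s"
    and hess: "\<And>i j. i \<le> s \<Longrightarrow> j \<le> s \<Longrightarrow> Suc i < j \<Longrightarrow> A $$ (i, j) = 0"
  shows "cofactor A a 0 = (\<Prod>i<a. - A $$ (i, Suc i)) *
    det (mat (s - a) (s - a) (\<lambda>(i, j). A $$ (Suc a + i, Suc a + j)))"
proof -
  define P where "P = mat a a (\<lambda>(i, j). A $$ (i, Suc j))"
  define R where "R = mat (s - a) a (\<lambda>(i, j). A $$ (Suc a + i, Suc j))"
  define Q where "Q = mat (s - a) (s - a) (\<lambda>(i, j). A $$ (Suc a + i, Suc a + j))"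
  have "mat_delete A a 0 = four_block_mat P (0\<^sub>m a (s - a)) R Q"
    using A a hess by (intro eq_matI) (auto simp: mat_delete_def P_def Q_def R_def)
  moreover have "det (four_block_mat P (0\<^sub>m a (s - a)) R Q) = det P * det Q"
    by (rule det_four_block_mat_upper_right_zero) (auto simp: P_def Q_def R_def)
  ultimately have "det (mat_delete A a 0) = det P * det Q"
    by simp
  moreover have "det P = prod_list (diag_mat P)"
    by (rule det_lower_triangular[where n = a]) (use a hess in \<open>auto simp: P_def\<close>)
  then have "det P = (\<Prod>i<a. A $$ (i, Suc i))"
    by (simp add: prod_list_diag_prod P_def atLeast0LessThan)
  moreover have "(-1) ^ a * (\<Prod>i<a. A $$ (i, Suc i)) = (\<Prod>i<a. - A $$ (i, Suc i))"
    by (simp add: prod_uminus)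
  ultimately show ?thesis
    by (simp add: cofactor_def Q_def mult.assoc[symmetric])
qed

lemma pick_atLeastAtMost:
  assumes "a + i \<le> b"
  shows "pick {a..b} i = a + i"
  using assms
proof (induction i)
  case 0
  then show ?case by (auto intro!: Least_equality)
next
  case (Suc i)
  then show ?case by (auto intro!: Least_equality)
qed

lemma block_eq_mat:
  assumes L: "L \<in> carrier_mat (Suc s) (Suc s)"
  shows "block L (Suc a) s = mat (s - a) (s - a) (\<lambda>(i, j). L $$ (Suc a + i, Suc a + j))"
proof -
  have "{i. i < Suc s \<and> i \<in> {Suc a..s}} = {Suc a..s}"
    by auto
  then show ?thesis
    using L by (intro eq_matI) (auto simp: block_def submatrix_def pick_atLeastAtMost)
qed

section \<open>Transition matrices that climb by at most one\<close>

lemma transition_matrixD: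
  assumes "transition_matrix s L"
  shows "L \<in> carrier_mat (Suc s) (Suc s)"
    and "\<And>i j. i \<le> s \<Longrightarrow> j \<le> s \<Longrightarrow> 0 \<le> L $$ (i, j)"
    and "\<And>i. i \<le> s \<Longrightarrow> (\<Sum>j\<in>{0..s}. L $$ (i, j)) = 1"
  using assms by (auto simp: transition_matrix_def)

lemma above_superdiagonal_zero:
  assumes "transition_matrix s L" "almost_lower_triangular s L"
    and "i \<le> s" "j \<le> s" "Suc i < j"
  shows "L $$ (i, j) = 0"
proof -
  have "\<not> L $$ (i, j) > 0"
    using assms by (fastforce simp: almost_lower_triangular_def)
  then show ?thesis
    using transition_matrixD(2)[OF assms(1,3,4)] by simp
qed

text \<open>Otherwise \<open>[0,k]\<close> would be closed: no power of \<open>L\<close> could lead from it to \<open>k + 1\<close>.\<close>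

lemma superdiagonal_pos:
  assumes tr: "transition_matrix s L" and alt: "almost_lower_triangular s L"
    and irr: "irreducible_matrix s L" and k: "k < s"
  shows "L $$ (k, Suc k) > 0"
proof (rule ccontr)
  note L = transition_matrixD[OF tr]
  assume "\<not> L $$ (k, Suc k) > 0"
  then have k0: "L $$ (k, Suc k) = 0"
    using L(2)[of k "Suc k"] k by simp
  have closed: "L $$ (i, j) = 0" if "i \<le> k" "k < j" "j \<le> s" for i j
  proof (cases "Suc i < j")
    case True
    then show ?thesis
      using above_superdiagonal_zero[OF tr alt] that k by simp
  next
    case False
    then have "i = k" "j = Suc k"
      using that by auto
    then show ?thesis
      using k0 by simp
  qed
  have "(L ^\<^sub>m n) $$ (i, j) = 0" if "i \<le> k" "k < j" "j \<le> s" for n i j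
    using that
  proof (induction n arbitrary: i j)
    case 0
    then show ?case
      using L(1) k by auto
  next
    case (Suc n)
    have "(L ^\<^sub>m n) $$ (i, l) * L $$ (l, j) = 0" if "l \<le> s" for l
      using Suc closed[of l j] that by (cases "l \<le> k") auto
    then have "(\<Sum>l\<in>{0..<Suc s}. (L ^\<^sub>m n) $$ (i, l) * L $$ (l, j)) = 0"
      by (intro sum.neutral) auto
    moreover have "L ^\<^sub>m n \<in> carrier_mat (Suc s) (Suc s)"
      using L(1) by (rule pow_carrier_mat)
    ultimately show ?case
      using Suc.prems L(1) k by (simp add: scalar_prod_def del: sum.op_ivl_Suc)
  qed
  then have "\<not> (L ^\<^sub>m n) $$ (k, Suc k) > 0" for n
    using k by simp
  moreover have "\<exists>n. (L ^\<^sub>m n) $$ (k, Suc k) > 0"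
    using irr k by (simp add: irreducible_matrix_def)
  ultimately show False
    by blast
qed

text \<open>Summing the invariance equations over the states above \<open>k\<close> says that the flow up through the
  cut equals the flow down; upwards, only the step from \<open>k\<close> to \<open>k + 1\<close> is possible.\<close>

lemma cut_balance:
  assumes tr: "transition_matrix s L" and alt: "almost_lower_triangular s L"
    and inv: "\<And>b. b \<le> s \<Longrightarrow> (\<Sum>a\<in>{0..s}. x a * L $$ (a, b)) = x b"
    and k: "k < s"
  shows "x k * L $$ (k, Suc k) = (\<Sum>a\<in>{Suc k..s}. x a * (\<Sum>b\<in>{0..k}. L $$ (a, b)))"
proof -
  define up where "up a = (\<Sum>b\<in>{Suc k..s}. L $$ (a, b))" for a
  have "up a = 0" if "a < k" for a
    using that above_superdiagonal_zero[OF tr alt] by (auto simp: up_def intro!: sum.neutral)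
  then have low: "(\<Sum>a\<in>{0..<k}. x a * up a) = 0"
    by simp
  have "up k = L $$ (k, Suc k) + (\<Sum>b\<in>{Suc (Suc k)..s}. L $$ (k, b))"
    using k by (simp add: up_def sum.atLeast_Suc_atMost)
  also have "(\<Sum>b\<in>{Suc (Suc k)..s}. L $$ (k, b)) = 0"
    using above_superdiagonal_zero[OF tr alt] by (intro sum.neutral) auto
  finally have upk: "up k = L $$ (k, Suc k)"
    by simp
  have down: "(\<Sum>b\<in>{0..k}. L $$ (a, b)) = 1 - up a" if "a \<le> s" for a
  proof -
    have "{0..s} = {0..k} \<union> {Suc k..s}"
      using k by auto
    then have "(\<Sum>b\<in>{0..s}. L $$ (a, b)) = (\<Sum>b\<in>{0..k}. L $$ (a, b)) + up a"
      by (simp add: up_def sum.union_disjoint)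
    then show ?thesis
      using transition_matrixD(3)[OF tr that] by simp
  qed
  have "(\<Sum>b\<in>{Suc k..s}. x b) = (\<Sum>b\<in>{Suc k..s}. \<Sum>a\<in>{0..s}. x a * L $$ (a, b))"
    using inv by simp
  also have "\<dots> = (\<Sum>a\<in>{0..s}. x a * up a)"
    by (subst sum.swap) (simp add: up_def sum_distrib_left)
  also have "{0..s} = {0..<k} \<union> {k..s}"
    using k by auto
  also have "(\<Sum>a\<in>\<dots>. x a * up a) = (\<Sum>a\<in>{k..s}. x a * up a)"
    using low by (subst sum.union_disjoint) auto
  also have "\<dots> = x k * L $$ (k, Suc k) + (\<Sum>a\<in>{Suc k..s}. x a * up a)"
    using k by (simp add: sum.atLeast_Suc_atMost upk)
  finally have "x k * L $$ (k, Suc k) = (\<Sum>a\<in>{Suc k..s}. x a - x a * up a)"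
    by (simp add: sum_subtractf)
  also have "\<dots> = (\<Sum>a\<in>{Suc k..s}. x a * (\<Sum>b\<in>{0..k}. L $$ (a, b)))"
    by (intro sum.cong) (auto simp: down right_diff_distrib)
  finally show ?thesis .
qed

text \<open>Descending induction along the cuts. Applied to \<open>x\<close> and \<open>- x\<close>, the lemma also shows that an
  invariant vector is determined by its last coordinate.\<close>

lemma invariant_nonneg_from_last:
  assumes tr: "transition_matrix s L" and alt: "almost_lower_triangular s L"
    and irr: "irreducible_matrix s L"
    and inv: "\<And>b. b \<le> s \<Longrightarrow> (\<Sum>a\<in>{0..s}. x a * L $$ (a, b)) = x b"
    and last: "x s \<ge> 0" and "k \<le> s"
  shows "x k \<ge> 0"
  using \<open>k \<le> s\<close>
proof (induction "s - k" arbitrary: k rule: less_induct)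
  case less
  show ?case
  proof (cases "k = s")
    case True
    then show ?thesis
      using last by simp
  next
    case False
    then have k: "k < s"
      using less.prems by simp
    have "0 \<le> (\<Sum>a\<in>{Suc k..s}. x a * (\<Sum>b\<in>{0..k}. L $$ (a, b)))"
      using less.hyps k transition_matrixD(2)[OF tr]
      by (intro sum_nonneg mult_nonneg_nonneg) auto
    then have "0 \<le> x k * L $$ (k, Suc k)"
      using cut_balance[OF tr alt inv k] by simp
    then show ?thesis
      using superdiagonal_pos[OF tr alt irr k] by (simp add: zero_le_mult_iff)
  qed
qed

section \<open>The invariant measure\<close>

lemma eta_cofactor:
  assumes tr: "transition_matrix s L" and alt: "almost_lower_triangular s L" and a: "a \<le> s"
  shows "eta s L c $ a = c * cofactor (1\<^sub>m (Suc s) - L) a 0"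
proof -
  let ?A = "1\<^sub>m (Suc s) - L"
  note L = transition_matrixD(1)[OF tr]
  have "?A $$ (i, j) = 0" if "i \<le> s" "j \<le> s" "Suc i < j" for i j
    using that L above_superdiagonal_zero[OF tr alt that] by simp
  then have "cofactor ?A a 0 = (\<Prod>i<a. - ?A $$ (i, Suc i)) *
      det (mat (s - a) (s - a) (\<lambda>(i, j). ?A $$ (Suc a + i, Suc a + j)))"
    using L a by (intro cofactor_first_column) (auto intro!: minus_carrier_mat)
  also have "(\<Prod>i<a. - ?A $$ (i, Suc i)) = (\<Prod>i<a. L $$ (i, Suc i))"
    using L a by (intro prod.cong) auto
  also have "\<dots> = (\<Prod>i\<in>{1..a}. L $$ (i - 1, i))"
    by (rule prod.reindex_bij_witness[of _ "\<lambda>i. i - 1" Suc]) auto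
  also have "mat (s - a) (s - a) (\<lambda>(i, j). ?A $$ (Suc a + i, Suc a + j)) =
      1\<^sub>m (s - a) - block L (a + 1) s"
    using L by (intro eq_matI) (auto simp: block_eq_mat)
  finally show ?thesis
    using a by (simp add: eta_def)
qed

text \<open>Row \<open>0\<close> of \<open>adj A * A = det A \<cdot> Id\<close> for the singular matrix \<open>A = Id - L\<close>.\<close>

lemma eta_invariant:
  assumes tr: "transition_matrix s L" and alt: "almost_lower_triangular s L" and b: "b \<le> s"
  shows "(\<Sum>a\<in>{0..s}. eta s L c $ a * L $$ (a, b)) = eta s L c $ b"
proof -
  define A where "A = 1\<^sub>m (Suc s) - L"
  note L = transition_matrixD[OF tr]
  have A: "A \<in> carrier_mat (Suc s) (Suc s)"
    using L(1) by (auto simp: A_def intro!: minus_carrier_mat)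
  let ?one = "vec (Suc s) (\<lambda>_. 1 :: real)"
  have "A *\<^sub>v ?one = 0\<^sub>v (Suc s)"
  proof (intro eq_vecI)
    fix i assume "i < dim_vec (0\<^sub>v (Suc s) :: real vec)"
    then have i: "i \<le> s"
      by simp
    then have "(A *\<^sub>v ?one) $ i = (\<Sum>j\<in>{0..s}. (if i = j then 1 else 0) - L $$ (i, j))"
      using L(1) by (auto simp: A_def scalar_prod_def atLeastLessThanSuc_atLeastAtMost
          intro!: sum.cong)
    also have "\<dots> = 0"
      using i L(3)[OF i] by (simp add: sum_subtractf)
    finally show "(A *\<^sub>v ?one) $ i = 0\<^sub>v (Suc s) $ i"
      using i by simp
  qed (use A in simp)
  moreover have "?one \<noteq> 0\<^sub>v (Suc s)"
    by (metis index_vec index_zero_vec(1) zero_less_Suc zero_neq_one)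
  ultimately have "det A = 0"
    unfolding det_0_iff_vec_prod_zero[OF A] by (intro exI[of _ ?one]) simp
  then have "(adj_mat A * A) $$ (0, b) = 0"
    using adj_mat(3)[OF A] b by simp
  then have "0 = (\<Sum>a\<in>{0..s}. cofactor A a 0 * A $$ (a, b))"
    using A adj_mat(1)[OF A] b
    by (simp add: scalar_prod_def adj_mat_def atLeastLessThanSuc_atLeastAtMost)
  also have "\<dots> = (\<Sum>a\<in>{0..s}. (if a = b then cofactor A a 0 else 0) -
      cofactor A a 0 * L $$ (a, b))"
    using L(1) b by (intro sum.cong) (auto simp: A_def right_diff_distrib)
  also have "\<dots> = cofactor A b 0 - (\<Sum>a\<in>{0..s}. cofactor A a 0 * L $$ (a, b))"
    using b by (simp add: sum_subtractf)
  finally have "(\<Sum>a\<in>{0..s}. cofactor A a 0 * L $$ (a, b)) = cofactor A b 0"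
    by simp
  then show ?thesis
    using b by (simp add: eta_cofactor[OF tr alt] A_def[symmetric] mult.assoc
        sum_distrib_left[symmetric])
qed

theorem theorem2p16:
  fixes s :: nat and L :: "real mat" and c :: real
  assumes "transition_matrix s L"
    and "almost_lower_triangular s L"
    and "irreducible_matrix s L"
    and "c > 0"
  shows "invariant_measure s L (eta s L c) \<and>
    (\<forall>\<mu>. invariant_measure s L \<mu> \<longrightarrow> (\<exists>k>0. \<mu> = k \<cdot>\<^sub>v eta s L c))"
proof -
  let ?\<eta> = "eta s L c"
  note nonneg = invariant_nonneg_from_last[OF assms(1-3)]
  have dim: "?\<eta> \<in> carrier_vec (Suc s)"
    by (simp add: eta_def)
  have last: "?\<eta> $ s > 0"
  proof -
    have "(\<Prod>i\<in>{1..s}. L $$ (i - 1, i)) > 0"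
    proof (intro prod_pos ballI)
      fix i assume "i \<in> {1..s}"
      then show "L $$ (i - 1, i) > 0"
        using superdiagonal_pos[OF assms(1-3), of "i - 1"] by auto
    qed
    moreover have "det (1\<^sub>m 0 - block L (s + 1) s) = 1"
      by (rule det_dim_zero)
        (auto simp: block_eq_mat[OF transition_matrixD(1)[OF assms(1)]] intro!: minus_carrier_mat)
    ultimately show ?thesis
      using \<open>c > 0\<close> by (simp add: eta_def)
  qed
  have "?\<eta> $ a \<ge> 0" if "a \<le> s" for a
    using nonneg[of "\<lambda>a. ?\<eta> $ a", OF eta_invariant[OF assms(1,2)]] last that by simp
  moreover have "?\<eta> \<noteq> 0\<^sub>v (Suc s)"
    using last by (metis index_zero_vec(1) lessI less_irrefl)
  ultimately have "invariant_measure s L ?\<eta>"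
    using dim eta_invariant[OF assms(1,2)] by (simp add: invariant_measure_def is_measure_def)
  moreover have "\<exists>k>0. \<mu> = k \<cdot>\<^sub>v ?\<eta>" if \<mu>: "invariant_measure s L \<mu>" for \<mu>
  proof -
    have \<mu>dim: "\<mu> \<in> carrier_vec (Suc s)" and \<mu>0: "\<mu> \<noteq> 0\<^sub>v (Suc s)" and \<mu>s: "\<mu> $ s \<ge> 0"
      and \<mu>inv: "\<And>b. b \<le> s \<Longrightarrow> (\<Sum>a\<in>{0..s}. \<mu> $ a * L $$ (a, b)) = \<mu> $ b"
      using \<mu> by (auto simp: invariant_measure_def is_measure_def)
    define k where "k = \<mu> $ s / ?\<eta> $ s"
    define x where "x a = \<mu> $ a - k * ?\<eta> $ a" for a
    have xs: "x s = 0"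
      using last by (simp add: x_def k_def)
    have xinv: "(\<Sum>a\<in>{0..s}. x a * L $$ (a, b)) = x b" if "b \<le> s" for b
      using \<mu>inv[OF that] eta_invariant[OF assms(1,2) that, of c]
      by (simp add: x_def left_diff_distrib sum_subtractf mult.assoc sum_distrib_left[symmetric])
    \<comment> \<open>The difference \<open>x\<close> is invariant with last coordinate \<open>0\<close>, and so is \<open>- x\<close>.\<close>
    have "x a = 0" if "a \<le> s" for a
    proof (rule antisym)
      show "0 \<le> x a"
        using nonneg[of x, OF xinv] xs that by simp
      have "(\<Sum>a\<in>{0..s}. - x a * L $$ (a, b)) = - x b" if "b \<le> s" for b
        using xinv[OF that] by (simp add: sum_negf)
      then show "x a \<le> 0"
        using nonneg[of "\<lambda>a. - x a" a] xs that by simp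
    qed
    then have eq: "\<mu> = k \<cdot>\<^sub>v ?\<eta>"
      using dim \<mu>dim by (intro eq_vecI) (auto simp: x_def)
    moreover have "k \<noteq> 0"
      using eq \<mu>0 dim by auto
    moreover have "k \<ge> 0"
      using \<mu>s last by (simp add: k_def)
    ultimately show ?thesis
      by (intro exI[of _ k]) simp
  qed
  ultimately show ?thesis
    by blast
qed

end
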